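(* For the locally free semigroup on $n$ generators, with the random walk driven by the uniform measure on the generators, the logarithmic volume $v$, the drift $l$ and the entropy $h$ satisfy, for all sufficiently large $n$, the strict inequality $$v\,l>h.$$
   Context: The locally free semigroup on $n$ generators is the semigroup (monoid) with generators $f_1,\dots,f_n$ and defining relations $f_jf_k=f_kf_j$ for $|j-k|\ge 2$. The length of an element is the minimal length of a word in the generators representing it. The logarithmic volume is $v=\lim_{K\to\infty}\frac{\log V(K)}{K}$, where $V(K)$ is the number of elements of length $K$. The random walk starts at the identity and at each step multiplies on the right by a generator chosen uniformly (probability $\frac1n$ each) and independently. The drift is $l=\limsup_{N\to\infty}\frac{L(N)}{N}$, where $L(N)$ is the expected length of the position after $N$ steps. The entropy is $h=\lim_{N\to\infty}\frac{H(\mu^N)}{N}$, where $\mu^N$ is the law of the position after $N$ steps and $H(\nu)=-\sum_{x\in\operatorname{supp}\nu}\nu(x)\log\nu(x)$. *)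

theory Defs
  imports "HOL-Algebra.Group" "HOL-Probability.Probability"
begin

inductive lf_cong :: "nat \<Rightarrow> nat list \<Rightarrow> nat list \<Rightarrow> bool" for n :: nat where
  lf_comm: "\<lbrakk>j \<in> {1..n}; k \<in> {1..n}; \<bar>int j - int k\<bar> \<ge> 2\<rbrakk> \<Longrightarrow> lf_cong n [j, k] [k, j]"
| lf_refl: "set u \<subseteq> {1..n} \<Longrightarrow> lf_cong n u u"
| lf_sym: "lf_cong n u w \<Longrightarrow> lf_cong n w u"
| lf_trans: "\<lbrakk>lf_cong n u v; lf_cong n v w\<rbrakk> \<Longrightarrow> lf_cong n u w"
| lf_append: "\<lbrakk>lf_cong n u w; lf_cong n u' w'\<rbrakk> \<Longrightarrow> lf_cong n (u @ u') (w @ w')"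

definition lf_rel :: "nat \<Rightarrow> (nat list \<times> nat list) set" where
  "lf_rel n = {(u, w). lf_cong n u w}"

text \<open>The letter \<open>i\<close> stands for \<open>f\<^sub>i\<close>; elements are congruence classes of words,
  so the words representing an element are its members.\<close>

definition locally_free :: "nat \<Rightarrow> nat list set monoid" where
  "locally_free n =
     \<lparr>carrier = lists {1..n} // lf_rel n,
      monoid.mult = (\<lambda>x y. \<Union>u\<in>x. \<Union>w\<in>y. lf_rel n `` {u @ w}),
      monoid.one = lf_rel n `` {[]}\<rparr>"

definition lf_gen :: "nat \<Rightarrow> nat \<Rightarrow> nat list set" where
  "lf_gen n i = lf_rel n `` {[i]}"

definition lf_length :: "nat list set \<Rightarrow> nat" where
  "lf_length x = (LEAST k. \<exists>w\<in>x. length w = k)"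

definition lf_volume :: "nat \<Rightarrow> nat \<Rightarrow> nat" where
  "lf_volume n K = card {x \<in> carrier (locally_free n). lf_length x = K}"

definition log_volume :: "nat \<Rightarrow> real" where
  "log_volume n = lim (\<lambda>K. ln (real (lf_volume n K)) / real K)"

primrec lf_walk :: "nat \<Rightarrow> nat \<Rightarrow> nat list set pmf" where
  "lf_walk n 0 = return_pmf \<one>\<^bsub>locally_free n\<^esub>"
| "lf_walk n (Suc N) =
     bind_pmf (lf_walk n N)
       (\<lambda>x. map_pmf (\<lambda>i. x \<otimes>\<^bsub>locally_free n\<^esub> lf_gen n i) (pmf_of_set {1..n}))"

definition lf_mean_length :: "nat \<Rightarrow> nat \<Rightarrow> real" where
  "lf_mean_length n N = measure_pmf.expectation (lf_walk n N) (\<lambda>x. real (lf_length x))"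

text \<open>The library's \<open>limsup\<close> needs a complete lattice, hence the detour through \<open>ereal\<close>;
  the sequence takes values in \<open>[0, 1]\<close>, so nothing is lost.\<close>

definition drift :: "nat \<Rightarrow> real" where
  "drift n = real_of_ereal (limsup (\<lambda>N. ereal (lf_mean_length n N / real N)))"

text \<open>Meaningful for finitely supported laws only; see \<open>finite_set_lf_walk\<close> below.\<close>

definition pmf_entropy :: "'a pmf \<Rightarrow> real" where
  "pmf_entropy p = - (\<Sum>x\<in>set_pmf p. pmf p x * ln (pmf p x))"

definition walk_entropy :: "nat \<Rightarrow> real" where
  "walk_entropy n = lim (\<lambda>N. pmf_entropy (lf_walk n N) / real N)"

lemma lf_cong_set: "lf_cong n u w \<Longrightarrow> set u \<subseteq> {1..n} \<and> set w \<subseteq> {1..n}"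
  by (induction rule: lf_cong.induct) auto

lemma equiv_lf_rel: "equiv (lists {1..n}) (lf_rel n)"
proof (rule equivI)
  show "lf_rel n \<subseteq> lists {1..n} \<times> lists {1..n}"
    using lf_cong_set by (fastforce simp: lf_rel_def)
  show "refl_on (lists {1..n}) (lf_rel n)"
    by (auto simp: refl_on_def lf_rel_def intro!: lf_refl)
  show "sym (lf_rel n)"
    by (auto simp: sym_def lf_rel_def intro: lf_sym)
  show "trans (lf_rel n)"
    by (auto simp: trans_def lf_rel_def intro: lf_trans)
qed

lemma lf_mult_class:
  assumes "u \<in> lists {1..n}" "w \<in> lists {1..n}"
  shows "lf_rel n `` {u} \<otimes>\<^bsub>locally_free n\<^esub> lf_rel n `` {w} = lf_rel n `` {u @ w}"
proof -
  have "congruent2 (lf_rel n) (lf_rel n) (\<lambda>u w. lf_rel n `` {u @ w})"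
    by (auto simp: congruent2_def lf_rel_def intro: lf_append lf_sym lf_trans)
  from UN_equiv_class2[OF equiv_lf_rel equiv_lf_rel this assms]
  show ?thesis by (simp add: locally_free_def)
qed

lemma monoid_locally_free: "monoid (locally_free n)"
proof (rule monoidI)
  have carr: "carrier (locally_free n) = {lf_rel n `` {u} | u. u \<in> lists {1..n}}"
    by (auto simp: locally_free_def quotient_def)
  have one: "\<one>\<^bsub>locally_free n\<^esub> = lf_rel n `` {[]}"
    by (simp add: locally_free_def)
  show "\<one>\<^bsub>locally_free n\<^esub> \<in> carrier (locally_free n)"
    unfolding carr one by blast
  fix x assume "x \<in> carrier (locally_free n)"
  then obtain u where u: "u \<in> lists {1..n}" "x = lf_rel n `` {u}"
    unfolding carr by blast
  show "\<one>\<^bsub>locally_free n\<^esub> \<otimes>\<^bsub>locally_free n\<^esub> x = x" "x \<otimes>\<^bsub>locally_free n\<^esub> \<one>\<^bsub>locally_free n\<^esub> = x"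
    using u lf_mult_class[of "[]" n u] lf_mult_class[of u n "[]"] by (simp_all add: one)
  fix y assume "y \<in> carrier (locally_free n)"
  then obtain w where w: "w \<in> lists {1..n}" "y = lf_rel n `` {w}"
    unfolding carr by blast
  have uw: "u @ w \<in> lists {1..n}" using u w by simp
  show "x \<otimes>\<^bsub>locally_free n\<^esub> y \<in> carrier (locally_free n)"
    unfolding carr u w lf_mult_class[OF u(1) w(1)] using uw by blast
  fix z assume "z \<in> carrier (locally_free n)"
  then obtain t where t: "t \<in> lists {1..n}" "z = lf_rel n `` {t}"
    unfolding carr by blast
  have wt: "w @ t \<in> lists {1..n}" using t w by simp
  show "x \<otimes>\<^bsub>locally_free n\<^esub> y \<otimes>\<^bsub>locally_free n\<^esub> z =
        x \<otimes>\<^bsub>locally_free n\<^esub> (y \<otimes>\<^bsub>locally_free n\<^esub> z)"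
    using u w t uw wt by (simp add: lf_mult_class del: in_lists_conv_set append_in_lists_conv)
qed

lemma finite_set_lf_walk: "n \<ge> 1 \<Longrightarrow> finite (set_pmf (lf_walk n N))"
  by (induction N) (auto simp: set_pmf_of_set)

end

theory Submission
  imports Defs "HOL-Real_Asymp.Real_Asymp"
begin

text \<open>The relations preserve length, so the drift is \<open>1\<close> and the claim is \<open>h < v\<close>. Every element has a
  unique normal form, a word whose letters descend by steps of at most one. Their transfer matrix
  has Perron eigenvalue \<open>4 cos\<^sup>2 (pi / (n + 2))\<close>, so \<open>v\<close> is within \<open>O(1/n\<^sup>2)\<close> of \<open>ln 4\<close>. The entropy
  is at most the cross entropy relative to a product of letter weights \<open>x\<^sub>1, \<dots>, x\<^sub>n\<close> whose sums over
  spheres are bounded, and the uniform walk uses each letter equally often, whence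
  \<open>h \<le> - (ln x\<^sub>1 + \<dots> + ln x\<^sub>n) / n\<close>. The weights \<open>1/2, 1/4, \<dots>, 1/4, 1/2\<close> give \<open>h \<le> (1 - 1/n) ln 4\<close>,
  and the gap of order \<open>1/n\<close> beats the \<open>O(1/n\<^sup>2)\<close>.\<close>

section \<open>Subadditive sequences\<close>

text \<open>Fekete's lemma. Writing \<open>n = k * m + r\<close> with \<open>r < m\<close>, for an
  index \<open>m\<close> whose quotient is nearly minimal, bounds \<open>a n / n\<close> by
  \<open>a m / m\<close> up to an error of order \<open>1 / n\<close>.\<close>

lemma tendsto_subadditive:
  fixes a :: "nat \<Rightarrow> real"
  assumes nonneg: "\<And>n. 0 \<le> a n"
    and sub: "\<And>m n. a (m + n) \<le> a m + a n"
  shows "(\<lambda>n. a n / n) \<longlonglongrightarrow> (INF n\<in>{1..}. a n / n)"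
proof -
  define L where "L = (INF n\<in>{1..}. a n / n)"
  have bdd: "bdd_below ((\<lambda>n. a n / real n) ` {1..})"
    by (rule bdd_belowI[of _ 0]) (auto simp: nonneg)
  have lower: "L \<le> a n / n" if "n \<ge> 1" for n
    unfolding L_def using that by (intro cINF_lower bdd) auto
  have mult: "a (k * m + r) \<le> k * a m + a r" for k m r
  proof (induction k)
    case (Suc k)
    have "a (Suc k * m + r) \<le> a m + a (k * m + r)"
      using sub[of m "k * m + r"] by (simp add: add_ac)
    with Suc show ?case by (simp add: algebra_simps)
  qed simp
  have "(\<lambda>n. a n / n) \<longlonglongrightarrow> L"
  proof (rule LIMSEQ_I)
    fix e :: real assume e: "e > 0"
    have "\<exists>m\<in>{1..}. a m / real m < L + e / 2"
      unfolding L_def by (subst cINF_less_iff[symmetric]) (use e bdd in auto)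
    then obtain m :: nat where m: "m \<ge> 1" "a m / m < L + e / 2"
      by auto
    define B where "B = Max (a ` {..<m})"
    have B: "a r \<le> B" if "r < m" for r
      unfolding B_def using that by (intro Max_ge) auto
    have upper: "a n / n \<le> a m / m + B / n" if "n \<ge> 1" for n
    proof -
      have "a n = a (n div m * m + n mod m)" by simp
      also have "\<dots> \<le> real (n div m) * a m + a (n mod m)" by (rule mult)
      also have "\<dots> \<le> (real n / real m) * a m + B"
        using m by (intro add_mono mult_right_mono B nonneg of_nat_div_le_of_nat) auto
      finally show ?thesis using that by (simp add: field_simps)
    qed
    obtain N :: nat where N: "N > 2 * \<bar>B\<bar> / e" using reals_Archimedean2 by blast
    show "\<exists>N. \<forall>n\<ge>N. norm (a n / real n - L) < e"
    proof (intro exI[of _ "Suc N"] allI impI)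
      fix n assume n: "n \<ge> Suc N"
      then have "real n > 2 * \<bar>B\<bar> / e" using N by linarith
      then have "2 * \<bar>B\<bar> < e * n" using e by (simp add: field_simps)
      then have "2 * B < e * n" by linarith
      then have "B / n < e / 2" using n by (simp add: field_simps)
      moreover have "L \<le> a n / n" "a n / n \<le> a m / m + B / n"
        using lower[of n] upper[of n] n by auto
      ultimately show "norm (a n / real n - L) < e"
        using m(2) unfolding real_norm_def by linarith
    qed
  qed
  then show ?thesis unfolding L_def .
qed

section \<open>Entropy of finitely supported laws\<close>

lemma pmf_entropy_expectation:
  assumes "finite (set_pmf p)"
  shows "pmf_entropy p = measure_pmf.expectation p (\<lambda>x. - ln (pmf p x))"
  unfolding pmf_entropy_def
  by (subst integral_measure_pmf[OF assms]) (auto simp: sum_negf)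

lemma pmf_entropy_nonneg: "0 \<le> pmf_entropy p"
  unfolding pmf_entropy_def
  by (simp, intro sum_nonpos)
     (auto intro!: mult_nonneg_nonpos simp: pmf_le_1 pmf_positive ln_le_zero_iff)

text \<open>Gibbs' inequality, from \<open>ln t \<le> t - 1\<close>. The weight \<open>q\<close> may
  be unnormalised: its total mass costs only \<open>ln Z\<close>.\<close>

lemma pmf_entropy_le_cross_entropy:
  assumes fin: "finite (set_pmf p)"
    and q: "\<And>x. x \<in> set_pmf p \<Longrightarrow> q x > 0"
    and Z: "(\<Sum>x\<in>set_pmf p. q x) \<le> Z"
  shows "pmf_entropy p \<le> ln Z - measure_pmf.expectation p (\<lambda>x. ln (q x))"
proof -
  have sum1: "(\<Sum>x\<in>set_pmf p. pmf p x) = 1"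
    using sum_pmf_eq_1[OF fin] by simp
  have Zpos: "Z > 0"
    using sum_pos[OF fin set_pmf_not_empty, of q] q Z by auto
  have E: "measure_pmf.expectation p (\<lambda>x. ln (q x)) = (\<Sum>x\<in>set_pmf p. pmf p x * ln (q x))"
    by (subst integral_measure_pmf[OF fin]) auto
  have "(\<Sum>x\<in>set_pmf p. pmf p x * (ln (q x) - ln (pmf p x) - ln Z))
      \<le> (\<Sum>x\<in>set_pmf p. q x / Z - pmf p x)"
  proof (rule sum_mono)
    fix x assume x: "x \<in> set_pmf p"
    note pos = q[OF x] pmf_positive[OF x] Zpos
    have "ln (q x) - ln (pmf p x) - ln Z = ln (q x / pmf p x / Z)"
      using pos by (simp add: ln_div ln_mult)
    also have "\<dots> \<le> q x / pmf p x / Z - 1"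
      using pos by (intro ln_le_minus_one) auto
    finally have "pmf p x * (ln (q x) - ln (pmf p x) - ln Z) \<le> pmf p x * (q x / pmf p x / Z - 1)"
      using pos by (intro mult_left_mono) auto
    also have "\<dots> = q x / Z - pmf p x" using pos by (simp add: field_simps)
    finally show "pmf p x * (ln (q x) - ln (pmf p x) - ln Z) \<le> q x / Z - pmf p x" .
  qed
  also have "\<dots> = (\<Sum>x\<in>set_pmf p. q x) / Z - 1"
    by (simp add: sum_subtractf sum1 sum_divide_distrib)
  also have "\<dots> \<le> 0" using Z Zpos by simp
  finally show ?thesis
    unfolding pmf_entropy_def E
    by (simp add: right_diff_distrib sum_subtractf sum1 flip: sum_distrib_right)
qed

text \<open>A map can only merge atoms, and the entropy of an independent pair is the sum of the
  entropies. With \<open>f\<close> the monoid product this makes the entropy of the walk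
  subadditive.\<close>

lemma pmf_entropy_map_pair_le:
  assumes fin: "finite (set_pmf p)" "finite (set_pmf q)"
  shows "pmf_entropy (map_pmf f (pair_pmf p q)) \<le> pmf_entropy p + pmf_entropy q"
proof -
  define r where "r = map_pmf f (pair_pmf p q)"
  have finr: "finite (set_pmf r)" and finpq: "finite (set_pmf (pair_pmf p q))"
    using fin by (auto simp: r_def)
  have int: "integrable (pair_pmf p q) g" for g :: "_ \<Rightarrow> real"
    by (rule integrable_measure_pmf_finite[OF finpq])
  have "pmf_entropy r = measure_pmf.expectation (pair_pmf p q) (\<lambda>z. - ln (pmf r (f z)))"
    by (simp add: pmf_entropy_expectation[OF finr]) (simp add: r_def)
  also have "\<dots> \<le> measure_pmf.expectation (pair_pmf p q)
                   (\<lambda>z. - ln (pmf p (fst z)) + - ln (pmf q (snd z)))"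
  proof (rule integral_mono_AE[OF int int], rule AE_pmfI)
    fix z assume "z \<in> set_pmf (pair_pmf p q)"
    then have pos: "pmf p (fst z) > 0" "pmf q (snd z) > 0"
      by (auto simp: pmf_positive)
    \<comment> \<open>The point \<open>z\<close> is one of those sent to \<open>f z\<close>, so its
      mass is at most the mass of \<open>f z\<close> under \<open>r\<close>.\<close>
    have "pmf p (fst z) * pmf q (snd z) = measure (pair_pmf p q) {z}"
      by (cases z) (simp add: pmf_pair measure_pmf_single)
    also have "\<dots> \<le> measure (pair_pmf p q) (f -` {f z})"
      by (intro measure_pmf.finite_measure_mono) auto
    also have "\<dots> = pmf r (f z)" by (simp add: r_def pmf_map)
    finally have "ln (pmf p (fst z) * pmf q (snd z)) \<le> ln (pmf r (f z))"
      using pos by (intro ln_mono) auto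
    then show "- ln (pmf r (f z)) \<le> - ln (pmf p (fst z)) + - ln (pmf q (snd z))"
      using pos by (simp add: ln_mult)
  qed
  also have "\<dots> = pmf_entropy p + pmf_entropy q"
    by (subst Bochner_Integration.integral_add[OF int int])
       (simp add: pmf_entropy_expectation fin expectation_pair_pmf_fst[of p q "\<lambda>x. - ln (pmf p x)"]
          expectation_pair_pmf_snd[of p q "\<lambda>x. - ln (pmf q x)"] del: integral_minus)
  finally show ?thesis by (simp add: r_def)
qed

lemma expectation_replicate_pmf_sum_list:
  fixes f :: "'a \<Rightarrow> real"
  assumes fin: "finite (set_pmf p)"
  shows "measure_pmf.expectation (replicate_pmf N p) (\<lambda>w. sum_list (map f w)) =
         N * measure_pmf.expectation p f"
proof (induction N)
  case (Suc N)
  have "finite (set_pmf (pair_pmf p (replicate_pmf N p)))"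
    using fin finite_lists_length_eq[OF fin, of N] by (simp add: set_replicate_pmf in_lists_conv_set subset_eq)
  then have int: "integrable (pair_pmf p (replicate_pmf N p)) g" for g :: "_ \<Rightarrow> real"
    by (rule integrable_measure_pmf_finite)
  have "replicate_pmf (Suc N) p = map_pmf (\<lambda>z. fst z # snd z) (pair_pmf p (replicate_pmf N p))"
    by (simp add: pair_pmf_def map_pmf_def bind_assoc_pmf bind_return_pmf)
  then have "measure_pmf.expectation (replicate_pmf (Suc N) p) (\<lambda>w. sum_list (map f w)) =
    measure_pmf.expectation (pair_pmf p (replicate_pmf N p))
      (\<lambda>z. f (fst z) + sum_list (map f (snd z)))"
    by simp
  also have "\<dots> = measure_pmf.expectation p f + N * measure_pmf.expectation p f"
    by (subst Bochner_Integration.integral_add[OF int int])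
       (simp add: Suc expectation_pair_pmf_snd[of p _ "\<lambda>w. sum_list (map f w)"])
  finally show ?case by (simp add: algebra_simps)
qed simp

section \<open>Normal forms\<close>

abbreviation lf_class :: "nat \<Rightarrow> nat list \<Rightarrow> nat list set" where
  "lf_class n w \<equiv> lf_rel n `` {w}"

text \<open>Excluded are the factors \<open>[j, k]\<close> with \<open>Suc k < j\<close>, the
  commuting pairs in decreasing order.\<close>

abbreviation normal_word :: "nat list \<Rightarrow> bool" where
  "normal_word \<equiv> successively (\<lambda>a b. a \<le> Suc b)"

lemma lf_cong_mset: "lf_cong n u w \<Longrightarrow> mset u = mset w"
  by (induction rule: lf_cong.induct) auto

lemma lf_cong_length: "lf_cong n u w \<Longrightarrow> length u = length w"
  by (metis lf_cong_mset mset_eq_length)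

text \<open>The relations swap only letters that differ by at least two, so the order among the
  letters \<open>i\<close> and \<open>i + 1\<close> never changes.\<close>

lemma lf_cong_filter_adjacent:
  "lf_cong n u w \<Longrightarrow> filter (\<lambda>a. a \<in> {i, Suc i}) u = filter (\<lambda>a. a \<in> {i, Suc i}) w"
  by (induction rule: lf_cong.induct) auto

lemma lf_class_eq_iff:
  assumes "set u \<subseteq> {1..n}" "set w \<subseteq> {1..n}"
  shows "lf_class n u = lf_class n w \<longleftrightarrow> lf_cong n u w"
  using eq_equiv_class_iff[OF equiv_lf_rel, of u n w] assms
  by (auto simp: lf_rel_def)

lemma carrier_locally_free: "carrier (locally_free n) = lf_class n ` {w. set w \<subseteq> {1..n}}"
  by (auto simp: locally_free_def quotient_def image_def)

lemma lf_length_class: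
  assumes "set w \<subseteq> {1..n}"
  shows "lf_length (lf_class n w) = length w"
  unfolding lf_length_def
proof (rule Least_equality)
  show "\<exists>u\<in>lf_class n w. length u = length w"
    using lf_refl[OF assms] by (intro bexI[of _ w]) (auto simp: lf_rel_def)
qed (auto simp: lf_rel_def dest: lf_cong_length)

lemma lf_sphere_eq:
  "{x \<in> carrier (locally_free n). lf_length x = K} =
   lf_class n ` {w. set w \<subseteq> {1..n} \<and> length w = K}"
  unfolding carrier_locally_free using lf_length_class by (auto simp: image_iff)

text \<open>Letters of a normal word descend by steps of at most one, so \<open>j\<close> is only reached from above
  through \<open>j + 1\<close>.\<close>

lemma hd_filter_adjacent_normal_word:
  assumes "normal_word w" "w \<noteq> []" "j < hd w" "j \<in> set w"
  shows "\<exists>w'. filter (\<lambda>a. a \<in> {j, Suc j}) w = Suc j # w'"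
  using assms
proof (induction w)
  case (Cons a w)
  show ?case
  proof (cases "a = Suc j")
    \<comment> \<open>Here \<open>a\<close> is at least \<open>j + 2\<close>, so the filter drops it
      and the next letter is still above \<open>j\<close>.\<close>
    case False
    with Cons.prems have "w \<noteq> []" "j < hd w" "j \<in> set w" "normal_word w"
      by (auto simp: successively_Cons)
    with Cons.IH Cons.prems False show ?thesis by auto
  qed auto
qed simp

text \<open>It suffices to compare first letters. The smaller one, say \<open>a\<close>, starts the
  projection of its own word onto \<open>a\<close> and \<open>a + 1\<close>, whereas in the other
  word \<open>a + 1\<close> comes first.\<close>

lemma normal_word_unique:
  assumes "normal_word u" "normal_word w" "mset u = mset w"
    and "\<And>i. filter (\<lambda>a. a \<in> {i, Suc i}) u = filter (\<lambda>a. a \<in> {i, Suc i}) w"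
  shows "u = w"
  using assms
proof (induction u arbitrary: w)
  case (Cons a u)
  then obtain b w' where w: "w = b # w'" by (cases w) auto
  have "\<not> a < b"
  proof
    assume "a < b"
    moreover have "a \<in> set w" using Cons.prems(3) by (metis list.set_intros(1) mset_eq_setD)
    ultimately obtain v where "filter (\<lambda>x. x \<in> {a, Suc a}) w = Suc a # v"
      using hd_filter_adjacent_normal_word[OF Cons.prems(2)] w by auto
    with Cons.prems(4)[of a] show False by simp
  qed
  moreover have "\<not> b < a"
  proof
    assume "b < a"
    moreover have "b \<in> set (a # u)" using Cons.prems(3) w by (metis list.set_intros(1) mset_eq_setD)
    ultimately obtain v where "filter (\<lambda>x. x \<in> {b, Suc b}) (a # u) = Suc b # v"
      using hd_filter_adjacent_normal_word[OF Cons.prems(1)] by fastforce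
    with Cons.prems(4)[of b] w show False by simp
  qed
  ultimately have ab: "a = b" by simp
  have "u = w'"
  proof (rule Cons.IH)
    fix i show "filter (\<lambda>a. a \<in> {i, Suc i}) u = filter (\<lambda>a. a \<in> {i, Suc i}) w'"
      using Cons.prems(4)[of i] ab w by (auto split: if_splits)
  qed (use Cons.prems ab w in \<open>auto simp: successively_Cons\<close>)
  with ab w show ?case by simp
qed simp

section \<open>Existence of normal forms\<close>

text \<open>Each letter is weighted by the number of letters to its right, so replacing
  \<open>[j, k]\<close> by \<open>[k, j]\<close> inside a word lowers the moment by
  \<open>j - k\<close> when \<open>k < j\<close>.\<close>

primrec letter_moment :: "nat list \<Rightarrow> nat" where
  "letter_moment [] = 0"
| "letter_moment (a # w) = a * length w + letter_moment w"

lemma letter_moment_append_less: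
  "length u = length w \<Longrightarrow> letter_moment u < letter_moment w \<Longrightarrow>
   letter_moment (p @ u) < letter_moment (p @ w)"
  by (induction p) auto

lemma not_normal_wordE:
  assumes "\<not> normal_word w"
  obtains p j k s where "w = p @ [j, k] @ s" "Suc k < j"
  using assms
proof (induction w arbitrary: thesis)
  case (Cons a w)
  show ?case
  proof (cases "normal_word w")
    case True
    with Cons.prems(2) obtain b v where "w = b # v" "Suc b < a"
      by (cases w) (auto simp: successively_Cons)
    with Cons.prems(1)[of "[]" a b v] show ?thesis by simp
  next
    case False
    then show ?thesis using Cons.IH Cons.prems(1)[of "a # _"] by (metis append_Cons)
  qed
qed simp

text \<open>A congruent word of least moment has no decreasing commuting pair left to swap.\<close>

lemma normal_word_exists:
  assumes "set w \<subseteq> {1..n}"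
  shows "\<exists>u. lf_cong n w u \<and> normal_word u"
proof -
  define u where "u = (ARG_MIN letter_moment u. lf_cong n w u)"
  have u: "lf_cong n w u" and min: "\<And>v. lf_cong n w v \<Longrightarrow> letter_moment u \<le> letter_moment v"
    unfolding u_def by (rule arg_min_nat_lemma[of "lf_cong n w", OF lf_refl[OF assms], THEN conjunct1],
      rule arg_min_nat_le) auto
  have "normal_word u"
  proof (rule ccontr)
    assume "\<not> normal_word u"
    then obtain p j k s where v: "u = p @ [j, k] @ s" "Suc k < j"
      by (rule not_normal_wordE)
    have "set u \<subseteq> {1..n}" using lf_cong_set[OF u] by simp
    then have "lf_cong n u (p @ [k, j] @ s)"
      unfolding v(1) using v(2) by (intro lf_append lf_comm lf_refl) auto
    then have "letter_moment u \<le> letter_moment (p @ [k, j] @ s)"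
      using u min lf_trans by blast
    moreover have "letter_moment ([k, j] @ s) < letter_moment ([j, k] @ s)"
      using v(2) by (simp add: algebra_simps)
    then have "letter_moment (p @ [k, j] @ s) < letter_moment (p @ [j, k] @ s)"
      by (intro letter_moment_append_less) auto
    ultimately show False using v by simp
  qed
  with u show ?thesis by blast
qed

section \<open>Transfer recursion for normal words\<close>

text \<open>The index \<open>j\<close> is the letter preceding the word, that is, the state of the
  transfer matrix. The fictitious letter \<open>0\<close> imposes no condition, so it serves as the
  initial state.\<close>

definition normal_words_after :: "nat \<Rightarrow> nat \<Rightarrow> nat \<Rightarrow> nat list set" where
  "normal_words_after n j K = {w. set w \<subseteq> {1..n} \<and> length w = K \<and> normal_word (j # w)}"

lemma finite_normal_words_after: "finite (normal_words_after n j K)"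
  unfolding normal_words_after_def
  by (rule finite_subset[OF _ finite_lists_length_eq[of "{1..n}" K]]) auto

lemma normal_words_after_0 [simp]: "normal_words_after n j 0 = {[]}"
  by (auto simp: normal_words_after_def)

lemma normal_words_after_start:
  "normal_words_after n 0 K = {w. set w \<subseteq> {1..n} \<and> length w = K \<and> normal_word w}"
  by (auto simp: normal_words_after_def successively_Cons)

text \<open>Splitting off the first letter is one application of the transfer matrix. The bound
  \<open>max 1 (j - 1)\<close> also covers \<open>j = 0\<close>, where the subtraction
  truncates.\<close>

lemma sum_normal_words_after_Suc:
  fixes f :: "nat list \<Rightarrow> real"
  shows "(\<Sum>w\<in>normal_words_after n j (Suc K). f w) =
         (\<Sum>k=max 1 (j - 1)..n. \<Sum>w\<in>normal_words_after n k K. f (k # w))"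
proof -
  have "normal_words_after n j (Suc K) =
        (\<Union>k\<in>{max 1 (j - 1)..n}. (#) k ` normal_words_after n k K)"
    by (auto simp: normal_words_after_def length_Suc_conv successively_Cons image_iff)
  then have "(\<Sum>w\<in>normal_words_after n j (Suc K). f w) =
    (\<Sum>k=max 1 (j - 1)..n. \<Sum>w\<in>(#) k ` normal_words_after n k K. f w)"
    by (simp only:) (rule sum.UNION_disjoint, auto simp: finite_normal_words_after)
  also have "\<dots> = (\<Sum>k=max 1 (j - 1)..n. \<Sum>w\<in>normal_words_after n k K. f (k # w))"
    by (rule sum.cong[OF refl]) (simp add: sum.reindex)
  finally show ?thesis .
qed

lemma sum_telescope_from:
  fixes F :: "nat \<Rightarrow> real"
  assumes "m \<le> Suc n"
  shows "(\<Sum>k=m..n. F k - F (Suc k)) = F m - F (Suc n)"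
  using sum_Suc_diff[OF assms, of F] by (simp add: sum_subtractf)

text \<open>A supersolution \<open>g\<close> of the weighted transfer matrix that dominates the
  weight of the empty word dominates the total weight for every length.\<close>

lemma weight_normal_words_after_le:
  fixes x g :: "nat \<Rightarrow> real"
  assumes "\<And>k. x k \<ge> 0" and "j \<le> n"
    and one: "\<And>j. j \<le> n \<Longrightarrow> 1 \<le> g j"
    and super: "\<And>j. j \<le> n \<Longrightarrow> (\<Sum>k=max 1 (j - 1)..n. x k * g k) \<le> g j"
  shows "(\<Sum>w\<in>normal_words_after n j K. prod_list (map x w)) \<le> g j"
  using \<open>j \<le> n\<close>
proof (induction K arbitrary: j)
  case (Suc K)
  have "(\<Sum>w\<in>normal_words_after n j (Suc K). prod_list (map x w)) =
    (\<Sum>k=max 1 (j - 1)..n. x k * (\<Sum>w\<in>normal_words_after n k K. prod_list (map x w)))"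
    by (simp add: sum_normal_words_after_Suc sum_distrib_left)
  also have "\<dots> \<le> (\<Sum>k=max 1 (j - 1)..n. x k * g k)"
    by (intro sum_mono mult_left_mono Suc.IH assms) auto
  also have "\<dots> \<le> g j" by (rule super[OF Suc.prems])
  finally show ?case .
qed (use one in auto)

text \<open>The counterpart from below: a subsolution \<open>T\<close> with factor \<open>c\<close>
  forces growth like \<open>c ^ K\<close> wherever \<open>T\<close> is positive.\<close>

lemma card_normal_words_after_ge:
  fixes T :: "nat \<Rightarrow> real"
  assumes "c \<ge> 0" and "j \<le> n"
    and one: "\<And>j. j \<le> n \<Longrightarrow> T j \<le> 1"
    and sub: "\<And>j. j \<le> n \<Longrightarrow> c * T j \<le> (\<Sum>k=max 1 (j - 1)..n. T k)"
  shows "c ^ K * T j \<le> card (normal_words_after n j K)"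
  using \<open>j \<le> n\<close>
proof (induction K arbitrary: j)
  case (Suc K)
  have "c ^ Suc K * T j = c ^ K * (c * T j)" by simp
  also have "\<dots> \<le> c ^ K * (\<Sum>k=max 1 (j - 1)..n. T k)"
    using \<open>c \<ge> 0\<close> by (intro mult_left_mono sub Suc.prems) auto
  also have "\<dots> = (\<Sum>k=max 1 (j - 1)..n. c ^ K * T k)" by (simp add: sum_distrib_left)
  also have "\<dots> \<le> (\<Sum>k=max 1 (j - 1)..n. real (card (normal_words_after n k K)))"
    by (intro sum_mono Suc.IH) auto
  also have "\<dots> = card (normal_words_after n j (Suc K))"
    using sum_normal_words_after_Suc[where f = "\<lambda>_. 1" and n = n and j = j and K = K] by simp
  finally show ?case .
qed (use one in auto)

section \<open>Volume\<close>

lemma finite_words: "finite {w :: nat list. set w \<subseteq> {1..n} \<and> length w = K}"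
  by (rule finite_lists_length_eq) simp

lemma lf_volume_pos:
  assumes "n \<ge> 1"
  shows "lf_volume n K > 0"
proof -
  have "replicate K 1 \<in> {w. set w \<subseteq> {1..n} \<and> length w = K}" using assms by auto
  then show ?thesis
    unfolding lf_volume_def lf_sphere_eq using finite_words[of n K]
    by (subst card_gt_0_iff) blast
qed

text \<open>Cutting a representing word after \<open>K\<close> letters factors the element, so the
  logarithm of the volume is subadditive.\<close>

lemma lf_volume_add_le: "lf_volume n (K + M) \<le> lf_volume n K * lf_volume n M"
proof -
  let ?W = "\<lambda>K. {w. set w \<subseteq> {1..n} \<and> length w = K}"
  have "lf_class n ` ?W (K + M) \<subseteq>
    (\<lambda>(x, y). x \<otimes>\<^bsub>locally_free n\<^esub> y) ` (lf_class n ` ?W K \<times> lf_class n ` ?W M)"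
  proof (safe, goal_cases)
    case (1 _ w)
    have in_W: "take K w \<in> ?W K" "drop K w \<in> ?W M"
      using 1 set_take_subset[of K w] set_drop_subset[of K w] by (auto simp del: set_take_subset)
    then have "lf_class n w = lf_class n (take K w) \<otimes>\<^bsub>locally_free n\<^esub> lf_class n (drop K w)"
      using lf_mult_class[of "take K w" n "drop K w"] by (auto simp: in_lists_conv_set subset_eq)
    then show ?case using in_W by (intro image_eqI[of _ _ "(lf_class n (take K w), lf_class n (drop K w))"]) auto
  qed
  then have "card (lf_class n ` ?W (K + M)) \<le> card (lf_class n ` ?W K \<times> lf_class n ` ?W M)"
    using finite_words by (intro surj_card_le) auto
  then show ?thesis
    unfolding lf_volume_def lf_sphere_eq by (simp add: card_cartesian_product)
qed

lemma convergent_log_volume: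
  assumes "n \<ge> 1"
  shows "convergent (\<lambda>K. ln (real (lf_volume n K)) / real K)"
proof (rule convergentI, rule tendsto_subadditive)
  fix K M
  show "0 \<le> ln (real (lf_volume n K))"
    using lf_volume_pos[OF assms, of K] by (intro ln_ge_zero) auto
  have "real (lf_volume n (K + M)) \<le> real (lf_volume n K) * real (lf_volume n M)"
    using lf_volume_add_le[of n K M] by (metis of_nat_le_iff of_nat_mult)
  then have "ln (real (lf_volume n (K + M))) \<le> ln (real (lf_volume n K) * real (lf_volume n M))"
    using lf_volume_pos[OF assms] by (intro ln_mono) auto
  then show "ln (real (lf_volume n (K + M))) \<le> ln (real (lf_volume n K)) + ln (real (lf_volume n M))"
    using lf_volume_pos[OF assms] by (simp add: ln_mult)
qed

text \<open>Distinct normal words represent distinct elements, since letter counts and projections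
  onto neighbouring letters are invariants of the class.\<close>

lemma card_normal_words_le_lf_volume: "card (normal_words_after n 0 K) \<le> lf_volume n K"
proof -
  have "inj_on (lf_class n) (normal_words_after n 0 K)"
  proof (rule inj_onI)
    fix u w assume uw: "u \<in> normal_words_after n 0 K" "w \<in> normal_words_after n 0 K"
      and "lf_class n u = lf_class n w"
    then have cong: "lf_cong n u w"
      by (subst (asm) lf_class_eq_iff) (auto simp: normal_words_after_start)
    show "u = w"
    proof (rule normal_word_unique)
      show "mset u = mset w" by (rule lf_cong_mset[OF cong])
      show "filter (\<lambda>a. a \<in> {i, Suc i}) u = filter (\<lambda>a. a \<in> {i, Suc i}) w" for i
        by (rule lf_cong_filter_adjacent[OF cong])
    qed (use uw in \<open>auto simp: normal_words_after_start\<close>)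
  qed
  then show ?thesis
    unfolding lf_volume_def lf_sphere_eq using finite_words
    by (intro card_inj_on_le[of "lf_class n"]) (auto simp: normal_words_after_start)
qed

text \<open>The transfer matrix of normal words is \<open>A j k = 1\<close> iff \<open>k \<ge> j - 1\<close>; its Perron eigenvector has
  the tail sums \<open>S j\<close> below, which satisfy \<open>c\<^sup>2 (S j - S (j + 1)) = S (j - 1)\<close>.\<close>

lemma log_volume_ge:
  assumes "n \<ge> 1"
  shows "2 * ln (2 * cos (pi / (n + 2))) \<le> log_volume n"
proof -
  \<comment> \<open>The angle makes \<open>sin ((n + 2) * t)\<close> vanish, which is the boundary
    condition \<open>S (Suc n) = 0\<close>. The \<open>max\<close> in \<open>T\<close> reflects that
    the states \<open>0\<close> and \<open>1\<close> allow the same next letters.\<close>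
  define t where "t = pi / real (n + 2)"
  define c where "c = 2 * cos t"
  define S where "S j = sin (real (Suc j) * t) / c ^ j" for j
  define T where "T j = S (max 1 j) - S (Suc (max 1 j))" for j
  have t: "0 < t" "real (n + 2) * t = pi" and t3: "t \<le> pi / 3"
    using assms by (auto simp: t_def field_simps)
  have "cos (pi / 3) \<le> cos t" using t t3 by (intro cos_monotone_0_pi_le) auto
  then have c: "c \<ge> 1" by (simp add: c_def cos_60)
  \<comment> \<open>From \<open>sin (a + t) + sin (a - t) = 2 * cos t * sin a\<close>, rescaled by
    powers of \<open>c\<close>.\<close>
  have S_rec: "c\<^sup>2 * (S (Suc j) - S (Suc (Suc j))) = S j" for j
  proof -
    have sin_rec: "sin (real (Suc j) * t) = c * sin (real (Suc (Suc j)) * t) - sin (real (Suc (Suc (Suc j))) * t)"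
      using sin_add[of "real (Suc (Suc j)) * t" t] sin_diff[of "real (Suc (Suc j)) * t" t]
      by (simp add: c_def algebra_simps)
    have "c\<^sup>2 * (p / c ^ Suc j - q / c ^ Suc (Suc j)) = (c * p - q) / c ^ j" for p q
      using c by (simp add: field_simps power2_eq_square)
    then show ?thesis
      unfolding S_def sin_rec .
  qed
  \<comment> \<open>The other boundary condition: for \<open>j \<le> 1\<close> the row sum is
    \<open>S 1\<close>, while the recurrence produces \<open>S 0\<close>.\<close>
  have S1: "S 1 = S 0"
    using c sin_double[of t] by (simp add: S_def c_def field_simps)
  have S_end: "S (Suc n) = 0"
    using t by (simp add: S_def)
  have S_pos: "0 < S j" if "j \<le> n" for j
  proof -
    have "real (Suc j) * t < real (n + 2) * t"
      using that t(1) by (intro mult_strict_right_mono) auto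
    then have "0 < sin (real (Suc j) * t)"
      using t(1) unfolding t(2) by (intro sin_gt_zero) simp_all
    then show ?thesis using c by (simp add: S_def)
  qed
  have S_le: "S j \<le> 1" for j
  proof -
    have "sin (real (Suc j) * t) \<le> 1 * 1" by simp
    also have "\<dots> \<le> 1 * c ^ j" using c by simp
    finally show ?thesis using c by (simp add: S_def)
  qed
  have T: "c\<^sup>2 * T j = S (max 1 (j - 1))" for j
  proof (cases "j \<le> 1")
    case True
    then have "max 1 j = Suc 0" "max 1 (j - 1) = 1" by auto
    then show ?thesis using S_rec[of 0] S1 by (simp add: T_def)
  next
    case False
    then obtain i where "j = Suc (Suc i)"
      using le_Suc_ex[of 2 j] by auto
    then show ?thesis using S_rec[of "Suc i"] by (simp add: T_def)
  qed
  have c2: "c\<^sup>2 \<ge> 1" using c by simp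
  have lower: "(c\<^sup>2) ^ K * T 0 \<le> lf_volume n K" for K
  proof -
    have "(c\<^sup>2) ^ K * T 0 \<le> card (normal_words_after n 0 K)"
    proof (rule card_normal_words_after_ge)
      fix j assume j: "j \<le> n"
      have "T j = S (max 1 (j - 1)) / c\<^sup>2" using T[of j] c by (auto simp: field_simps)
      also have "\<dots> \<le> 1" using S_le[of "max 1 (j - 1)"] c2 by (subst pos_divide_le_eq) linarith+
      finally show "T j \<le> 1" .
      have "(\<Sum>k=max 1 (j - 1)..n. T k) = (\<Sum>k=max 1 (j - 1)..n. S k - S (Suc k))"
        by (intro sum.cong refl) (simp add: T_def max_absorb2)
      also have "\<dots> = S (max 1 (j - 1)) - S (Suc n)"
        using j assms by (intro sum_telescope_from) auto
      finally show "c\<^sup>2 * T j \<le> (\<Sum>k=max 1 (j - 1)..n. T k)"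
        by (simp add: T S_end)
    qed auto
    also have "\<dots> \<le> lf_volume n K" using card_normal_words_le_lf_volume by simp
    finally show ?thesis .
  qed
  have "c\<^sup>2 * T 0 > 0" using T[of 0] S_pos[of 1] assms by simp
  then have T0: "T 0 > 0" using c2 by (simp add: zero_less_mult_iff)
  have lim: "(\<lambda>K. ln (T 0) / real K + 2 * ln c) \<longlonglongrightarrow> 0 + 2 * ln c"
    by (intro tendsto_intros lim_const_over_n)
  have "0 + 2 * ln c \<le> log_volume n"
    unfolding log_volume_def
  proof (rule LIMSEQ_le[OF lim])
    show "(\<lambda>K. ln (real (lf_volume n K)) / real K) \<longlonglongrightarrow> lim (\<lambda>K. ln (real (lf_volume n K)) / real K)"
      using convergent_log_volume[OF assms] by (simp add: convergent_LIMSEQ_iff)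
    show "\<exists>N. \<forall>K\<ge>N. ln (T 0) / real K + 2 * ln c \<le> ln (real (lf_volume n K)) / real K"
    proof (intro exI[of _ 1] allI impI)
      fix K :: nat assume K: "K \<ge> 1"
      have "ln ((c\<^sup>2) ^ K * T 0) \<le> ln (real (lf_volume n K))"
        using lower[of K] T0 c by (intro ln_mono) auto
      moreover have "ln ((c\<^sup>2) ^ K * T 0) = K * (2 * ln c) + ln (T 0)"
        using T0 c by (simp add: ln_mult ln_realpow)
      ultimately have "(K * (2 * ln c) + ln (T 0)) / K \<le> ln (real (lf_volume n K)) / K"
        by (intro divide_right_mono) auto
      then show "ln (T 0) / real K + 2 * ln c \<le> ln (real (lf_volume n K)) / real K"
        using K by (simp add: add_divide_distrib)
    qed
  qed
  then show ?thesis by (simp add: c_def t_def add.commute)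
qed

section \<open>The random walk\<close>

text \<open>The position is the class of a word of \<open>N\<close> independent uniform letters, so
  questions about the walk become questions about random words.\<close>

lemma lf_walk_eq_map:
  assumes "n \<ge> 1"
  shows "lf_walk n N = map_pmf (lf_class n) (replicate_pmf N (pmf_of_set {1..n}))"
proof (induction N)
  case 0
  show ?case by (simp add: locally_free_def)
next
  case (Suc N)
  let ?p = "pmf_of_set {1..n}"
  have p: "set_pmf ?p = {1..n}" using assms by (intro set_pmf_of_set) auto
  have "lf_walk n (Suc N) = replicate_pmf N ?p \<bind>
    (\<lambda>w. map_pmf (\<lambda>i. lf_class n w \<otimes>\<^bsub>locally_free n\<^esub> lf_gen n i) ?p)"
    by (simp add: Suc bind_map_pmf)
  also have "\<dots> = replicate_pmf N ?p \<bind> (\<lambda>w. map_pmf (\<lambda>i. lf_class n (w @ [i])) ?p)"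
    using p by (intro bind_pmf_cong map_pmf_cong refl)
      (auto simp: lf_gen_def set_replicate_pmf intro!: lf_mult_class)
  also have "\<dots> = map_pmf (lf_class n) (replicate_pmf (N + 1) ?p)"
    unfolding replicate_pmf_distrib replicate_pmf_1
    by (simp add: map_pmf_def bind_assoc_pmf bind_return_pmf)
  finally show ?case by simp
qed

lemma set_lf_walk:
  assumes "n \<ge> 1"
  shows "set_pmf (lf_walk n N) = lf_class n ` {w. set w \<subseteq> {1..n} \<and> length w = N}"
  using assms by (simp add: lf_walk_eq_map set_replicate_pmf lists_eq_set set_pmf_of_set Collect_conj_eq)

text \<open>All words for an element have the same length, so after \<open>N\<close> steps the
  length is exactly \<open>N\<close>.\<close>

lemma drift_eq_1:
  assumes "n \<ge> 1"
  shows "drift n = 1"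
proof -
  have "lf_mean_length n N = N" for N
  proof -
    have "lf_mean_length n N = measure_pmf.expectation (lf_walk n N) (\<lambda>_. real N)"
      unfolding lf_mean_length_def
      by (intro integral_cong_AE AE_pmfI) (auto simp: set_lf_walk[OF assms] lf_length_class)
    then show ?thesis by simp
  qed
  \<comment> \<open>At \<open>N = 0\<close> the quotient is \<open>0 / 0 = 0\<close>, so equality
    with 1 starts at \<open>N = 1\<close>.\<close>
  then have "eventually (\<lambda>N. ereal (lf_mean_length n N / real N) = 1) sequentially"
    by (auto simp: eventually_sequentially one_ereal_def intro!: exI[of _ 1])
  then have "limsup (\<lambda>N. ereal (lf_mean_length n N / real N)) = limsup (\<lambda>N. 1 :: ereal)"
    by (rule Limsup_eq)
  then show ?thesis by (simp add: drift_def Limsup_const)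
qed

lemma lf_walk_add:
  assumes "n \<ge> 1"
  shows "lf_walk n (N + M) =
    map_pmf (\<lambda>(x, y). x \<otimes>\<^bsub>locally_free n\<^esub> y) (pair_pmf (lf_walk n N) (lf_walk n M))"
proof -
  let ?p = "pmf_of_set {1..n}"
  have p: "set_pmf ?p = {1..n}" using assms by (intro set_pmf_of_set) auto
  have "lf_walk n (N + M) = replicate_pmf N ?p \<bind> (\<lambda>u. replicate_pmf M ?p \<bind>
    (\<lambda>w. return_pmf (lf_class n (u @ w))))"
    by (simp add: lf_walk_eq_map[OF assms] replicate_pmf_distrib map_bind_pmf)
  also have "\<dots> = replicate_pmf N ?p \<bind> (\<lambda>u. replicate_pmf M ?p \<bind>
    (\<lambda>w. return_pmf (lf_class n u \<otimes>\<^bsub>locally_free n\<^esub> lf_class n w)))"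
    using p by (intro bind_pmf_cong refl arg_cong[of _ _ return_pmf])
      (auto simp: set_replicate_pmf intro!: lf_mult_class[symmetric])
  also have "\<dots> = map_pmf (\<lambda>(x, y). x \<otimes>\<^bsub>locally_free n\<^esub> y) (pair_pmf (lf_walk n N) (lf_walk n M))"
    by (simp add: lf_walk_eq_map[OF assms] pair_pmf_def map_pmf_def bind_assoc_pmf bind_return_pmf)
  finally show ?thesis .
qed

lemma convergent_walk_entropy:
  assumes "n \<ge> 1"
  shows "convergent (\<lambda>N. pmf_entropy (lf_walk n N) / real N)"
proof (rule convergentI, rule tendsto_subadditive)
  show "pmf_entropy (lf_walk n (N + M)) \<le> pmf_entropy (lf_walk n N) + pmf_entropy (lf_walk n M)" for N M
    unfolding lf_walk_add[OF assms]
    by (intro pmf_entropy_map_pair_le finite_set_lf_walk assms)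
qed (rule pmf_entropy_nonneg)

section \<open>Upper bound for the entropy\<close>

text \<open>Cross entropy against the product of \<open>x\<close> over the normal form. This product
  depends only on letter counts, so its expected logarithm can be computed from the random word
  itself, while its sum over the sphere is controlled through normal words.\<close>

lemma pmf_entropy_lf_walk_le:
  fixes x :: "nat \<Rightarrow> real"
  assumes n: "n \<ge> 1" and x: "\<And>k. x k > 0"
    and Z: "(\<Sum>w\<in>normal_words_after n 0 N. prod_list (map x w)) \<le> Z"
  shows "pmf_entropy (lf_walk n N) \<le> ln Z - N * ((\<Sum>k=1..n. ln (x k)) / n)"
proof -
  let ?p = "pmf_of_set {1..n}"
  define nf where "nf X = (SOME u. u \<in> X \<and> normal_word u)" for X
  define q where "q X = prod_list (map x (nf X))" for X
  have nf: "lf_cong n w (nf (lf_class n w))" "normal_word (nf (lf_class n w))"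
    if "set w \<subseteq> {1..n}" for w
    using someI_ex[OF normal_word_exists[OF that]] by (simp_all add: nf_def lf_rel_def)
  have fin: "finite (set_pmf (lf_walk n N))" using n by (rule finite_set_lf_walk)
  have pos: "prod_list (map x w) > 0" for w by (induction w) (auto simp: x)
  \<comment> \<open>A normal form is a member of its class and therefore determines it.\<close>
  have "inj_on nf (set_pmf (lf_walk n N))"
  proof (rule inj_onI)
    fix X Y assume "X \<in> set_pmf (lf_walk n N)" "Y \<in> set_pmf (lf_walk n N)" and eq: "nf X = nf Y"
    then obtain u w where uw: "set u \<subseteq> {1..n}" "set w \<subseteq> {1..n}" "X = lf_class n u" "Y = lf_class n w"
      by (auto simp: set_lf_walk[OF n])
    then have "lf_cong n u w"
      using nf(1)[of u] nf(1)[of w] eq by (metis lf_sym lf_trans)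
    with uw show "X = Y" by (simp add: lf_class_eq_iff)
  qed
  then have "(\<Sum>X\<in>set_pmf (lf_walk n N). q X) =
    (\<Sum>w\<in>nf ` set_pmf (lf_walk n N). prod_list (map x w))"
    by (simp add: sum.reindex q_def)
  also have "\<dots> \<le> (\<Sum>w\<in>normal_words_after n 0 N. prod_list (map x w))"
  proof (rule sum_mono2[OF finite_normal_words_after])
    show "nf ` set_pmf (lf_walk n N) \<subseteq> normal_words_after n 0 N"
    proof
      fix v assume "v \<in> nf ` set_pmf (lf_walk n N)"
      then obtain w where w: "set w \<subseteq> {1..n}" "length w = N" and v: "v = nf (lf_class n w)"
        by (auto simp: set_lf_walk[OF n])
      show "v \<in> normal_words_after n 0 N"
        using nf[OF w(1)] lf_cong_set[OF nf(1)[OF w(1)]] lf_cong_length[OF nf(1)[OF w(1)]] w(2) v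
        by (simp add: normal_words_after_start)
    qed
  qed (use pos less_imp_le in blast)
  finally have "(\<Sum>X\<in>set_pmf (lf_walk n N). q X) \<le> Z" using Z by linarith
  then have "pmf_entropy (lf_walk n N) \<le>
    ln Z - measure_pmf.expectation (lf_walk n N) (\<lambda>X. ln (q X))"
    by (intro pmf_entropy_le_cross_entropy fin) (simp_all add: q_def pos)
  also have "measure_pmf.expectation (lf_walk n N) (\<lambda>X. ln (q X)) =
    measure_pmf.expectation (replicate_pmf N ?p) (\<lambda>w. sum_list (map (\<lambda>k. ln (x k)) w))"
    unfolding lf_walk_eq_map[OF n] integral_map_pmf
  proof (intro integral_cong_AE AE_pmfI)
    fix w assume "w \<in> set_pmf (replicate_pmf N ?p)"
    then have "set w \<subseteq> {1..n}" using n by (auto simp: set_replicate_pmf set_pmf_of_set)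
    then have mset: "mset (nf (lf_class n w)) = mset w"
      using lf_cong_mset nf(1) by metis
    have ln_prod: "ln (prod_list (map x v)) = sum_list (map (\<lambda>k. ln (x k)) v)" for v
      by (induction v) (simp_all add: ln_mult_pos x pos)
    have "q (lf_class n w) = prod_list (map x w)"
      unfolding q_def using mset by (metis mset_map prod_mset_prod_list)
    then show "ln (q (lf_class n w)) = sum_list (map (\<lambda>k. ln (x k)) w)" by (simp add: ln_prod)
  qed auto
  also have "\<dots> = N * measure_pmf.expectation ?p (\<lambda>k. ln (x k))"
    using n by (intro expectation_replicate_pmf_sum_list) (simp add: set_pmf_of_set)
  also have "measure_pmf.expectation ?p (\<lambda>k. ln (x k)) = (\<Sum>k=1..n. ln (x k)) / n"
    using n by (subst integral_pmf_of_set) auto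
  finally show ?thesis .
qed

text \<open>The first and last generator have only one non-commuting neighbour, so they can be given weight
  \<open>1/2\<close> instead of \<open>1/4\<close> while the total weight of each sphere stays bounded; \<open>g\<close> is the
  eigenvector of the weighted transfer matrix and \<open>F\<close> its tail sums.\<close>

lemma walk_entropy_le:
  assumes n: "n \<ge> 2"
  shows "walk_entropy n \<le> (1 - 1 / n) * ln 4"
proof -
  define x :: "nat \<Rightarrow> real" where "x k = (if k = 1 \<or> k = n then 1/2 else 1/4)" for k
  \<comment> \<open>The states \<open>0\<close>, \<open>1\<close> and \<open>2\<close> all allow
    every letter next, hence \<open>max j 2\<close>. The resulting equality of \<open>g 1\<close>
    and \<open>g 2\<close> and the cut-off of \<open>F\<close> beyond \<open>n\<close> are what
    raise the two end weights to \<open>1/2\<close>.\<close>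
  define g :: "nat \<Rightarrow> real" where "g j = 2 ^ n / 2 ^ (max j 2)" for j
  define F :: "nat \<Rightarrow> real" where "F j = (if j \<le> n then 2 ^ n / 2 ^ Suc j else 0)" for j
  have n1: "n \<ge> 1" using n by simp
  have x_pos: "x k > 0" for k by (simp add: x_def)
  have bound: "(\<Sum>w\<in>normal_words_after n 0 N. prod_list (map x w)) \<le> g 0" for N
  proof (rule weight_normal_words_after_le)
    fix j assume j: "j \<le> n"
    have "(2::real) ^ max j 2 \<le> 2 ^ n" using j n by (intro power_increasing) auto
    then show "1 \<le> g j" by (simp add: g_def)
    have "(\<Sum>k=max 1 (j - 1)..n. x k * g k) = (\<Sum>k=max 1 (j - 1)..n. F k - F (Suc k))"
    proof (rule sum.cong[OF refl])
      fix k assume "k \<in> {max 1 (j - 1)..n}"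
      then have "k \<ge> 1" "k \<le> n" by auto
      then consider "k = 1" | "k = n" "k \<ge> 2" | "2 \<le> k" "k < n" using n by linarith
      then show "x k * g k = F k - F (Suc k)"
        using n by cases (auto simp: x_def g_def F_def max_def field_simps power2_eq_square)
    qed
    also have "\<dots> = F (max 1 (j - 1)) - F (Suc n)"
      using j n by (intro sum_telescope_from) auto
    also have "\<dots> = g j"
    proof -
      have "Suc (max 1 (j - 1)) = max j 2" by auto
      moreover have "max 1 (j - 1) \<le> n" using j n by auto
      ultimately show ?thesis by (simp add: F_def g_def)
    qed
    finally show "(\<Sum>k=max 1 (j - 1)..n. x k * g k) \<le> g j" by simp
  qed (use x_pos less_imp_le in auto)
  have ln4: "ln (4::real) = 2 * ln 2" using ln_realpow[of 2 2] by simp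
  \<comment> \<open>For \<open>n \<ge> 2\<close> the end letters are distinct, and each contributes
    \<open>ln 2\<close> more than \<open>- ln 4\<close>, together one \<open>ln 4\<close>.\<close>
  have "(\<Sum>k=1..n. ln (x k)) =
    (\<Sum>k=1..n. - ln 4 + (if k = 1 then ln 2 else 0) + (if k = n then ln 2 else 0))"
    using n by (intro sum.cong refl) (auto simp: x_def ln_div ln4)
  also have "\<dots> = - (real n - 1) * ln 4"
    using n unfolding sum.distrib by (simp add: ln4 algebra_simps)
  finally have mean: "(\<Sum>k=1..n. ln (x k)) / n = - ((1 - 1 / n) * ln 4)"
    using n by (simp add: field_simps)
  have upper: "pmf_entropy (lf_walk n N) \<le> ln (g 0) + N * ((1 - 1 / n) * ln 4)" for N
    using pmf_entropy_lf_walk_le[of n x N, OF n1 x_pos bound] unfolding mean by simp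
  have lim: "(\<lambda>N. ln (g 0) / real N + (1 - 1 / n) * ln 4) \<longlonglongrightarrow> 0 + (1 - 1 / n) * ln 4"
    by (intro tendsto_intros lim_const_over_n)
  have "walk_entropy n \<le> 0 + (1 - 1 / n) * ln 4"
    unfolding walk_entropy_def
  proof (rule LIMSEQ_le[OF _ lim])
    show "(\<lambda>N. pmf_entropy (lf_walk n N) / real N) \<longlonglongrightarrow> lim (\<lambda>N. pmf_entropy (lf_walk n N) / real N)"
      using convergent_walk_entropy[OF n1] by (simp add: convergent_LIMSEQ_iff)
    show "\<exists>M. \<forall>N\<ge>M. pmf_entropy (lf_walk n N) / real N \<le> ln (g 0) / real N + (1 - 1 / n) * ln 4"
    proof (intro exI[of _ 1] allI impI)
      fix N :: nat assume "N \<ge> 1"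
      then have N: "real N > 0" by simp
      have "pmf_entropy (lf_walk n N) / real N \<le> (ln (g 0) + N * ((1 - 1 / n) * ln 4)) / N"
        using upper[of N] N by (intro divide_right_mono) auto
      also have "\<dots> = ln (g 0) / real N + (1 - 1 / n) * ln 4"
        using N by (simp add: add_divide_distrib)
      finally show "pmf_entropy (lf_walk n N) / real N \<le> ln (g 0) / real N + (1 - 1 / n) * ln 4" .
    qed
  qed
  then show ?thesis by simp
qed

section \<open>Comparison of the two bounds for large \<open>n\<close>\<close>

theorem theorem5:
  "\<exists>n0::nat. \<forall>n\<ge>n0.
     convergent (\<lambda>K. ln (real (lf_volume n K)) / real K) \<and>
     convergent (\<lambda>N. pmf_entropy (lf_walk n N) / real N) \<and>
     log_volume n * drift n > walk_entropy n"
proof -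
  \<comment> \<open>The left side behaves like \<open>- (pi / n) ^ 2\<close>, which eventually
    exceeds \<open>- (ln 4 / n)\<close>. Adding \<open>ln 4\<close> to both sides compares the lower
    bound for the volume with the upper bound for the entropy.\<close>
  have "eventually (\<lambda>n::nat. 2 * ln (cos (pi / (real n + 2))) > - (ln 4 / real n)) at_top"
    by real_asymp
  moreover have "eventually (\<lambda>n::nat. cos (pi / (real n + 2)) > 0) at_top"
    by real_asymp
  ultimately have "eventually (\<lambda>n::nat. (1 - 1 / real n) * ln 4 < 2 * ln (2 * cos (pi / (real n + 2)))) at_top"
  proof eventually_elim
    case (elim n)
    have "ln (4::real) = 2 * ln 2" using ln_realpow[of 2 2] by simp
    with elim show ?case by (simp add: ln_mult algebra_simps)
  qed
  then obtain n0 :: nat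
    where n0: "\<And>n. n \<ge> n0 \<Longrightarrow> (1 - 1 / n) * ln 4 < 2 * ln (2 * cos (pi / (real n + 2)))"
    by (auto simp: eventually_sequentially)
  show ?thesis
  proof (intro exI[of _ "max n0 2"] allI impI conjI)
    fix n assume "n \<ge> max n0 2"
    then have n: "n \<ge> n0" "n \<ge> 2" "n \<ge> 1" by auto
    show "convergent (\<lambda>K. ln (real (lf_volume n K)) / real K)"
      using n by (intro convergent_log_volume)
    show "convergent (\<lambda>N. pmf_entropy (lf_walk n N) / real N)"
      using n by (intro convergent_walk_entropy)
    show "walk_entropy n < log_volume n * drift n"
      using n0[OF n(1)] walk_entropy_le[OF n(2)] log_volume_ge[OF n(3)] drift_eq_1[OF n(3)]
      by (simp add: add.commute)
  qed
qed

end
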